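(* Let $a_0=0.429782\ldots$ be the root of the equation $\big(1-\tfrac23a^2\big)^2=\frac{1+a}{1+2a}$ in $0<a<1$. If $0<a\le a_0$, then $$\frac{as}{1+s}\le R_{id_1\to\partial}(a)\le \frac1a\Big(1-\sqrt{\frac{1+a}{1+2a}}\Big),$$ where $s\in[1,\infty)$ is the root of the equation $$\Big(\frac{[s]+1}{2}\Big(\frac{s}{s+1}\Big)^{[s]-1}\Big)^{1/2}\Big(\frac{1}{\big(1-a^2\frac{s}{s+1}\big)^2}-1\Big)=\frac{a}{1+a}.$$
   Context: $[s]$ denotes the integer part of $s$. $\mathbb{D}=\{|z|<1\}$, $\|f\|_\infty=\sup_{z\in\mathbb{D}}|f(z)|$. $R_{id_1\to\partial}(a)$ is the Bohr radius of the pair (identity, differentiation) with initial coefficient $a$: the supremum of the numbers $R\ge 0$ such that for every function $f(z)=\sum_{n\ge1}a_nz^n$ analytic in $\mathbb{D}$ with $|a_1|=a$ and $\|f\|_\infty\le1$ one has $$\sum_{n\ge1}n|a_n|r^{n-1}\le 1\quad\text{for all } 0\le r\le R .$$ *)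

theory Defs
  imports "HOL-Complex_Analysis.Complex_Analysis"
begin

definition sup_norm_disc :: "(complex \<Rightarrow> complex) \<Rightarrow> ereal" where
  "sup_norm_disc f = (SUP z\<in>ball 0 1. ereal (norm (f z)))"

(* The series are indexed from 0, so c n is the coefficient of z ^ n and the terms
   of index n \<ge> 1 appear with Suc n in place of n. The explicit summability condition is needed
   because suminf has no meaning for a divergent series, whose sum counts here as infinite.
   The supremum is taken in ereal: for a \<ge> 1 the set of admissible R is unbounded. *)
definition bohr_radius_id_deriv :: "real \<Rightarrow> ereal" where
  "bohr_radius_id_deriv a = Sup (ereal ` {R. R \<ge> 0 \<and>
     (\<forall>(f :: complex \<Rightarrow> complex) (c :: nat \<Rightarrow> complex).
        f holomorphic_on ball 0 1 \<and>
        (\<forall>z\<in>ball 0 1. (\<lambda>n. c (Suc n) * z ^ Suc n) sums f z) \<and>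
        norm (c 1) = a \<and> sup_norm_disc f \<le> 1 \<longrightarrow>
        (\<forall>r\<in>{0..R}. summable (\<lambda>n. real (Suc n) * norm (c (Suc n)) * r ^ n) \<and>
                      (\<Sum>n. real (Suc n) * norm (c (Suc n)) * r ^ n) \<le> 1))})"

end

(* Write f(z) = z g(z) with g = b_0 + b_1 z + ... and |b_0| = a. Multiplication by a function bounded
   by 1 does not increase the l2 norm of the coefficients up to a given index (Parseval on roots of
   unity); applied to the Moebius transform of g that vanishes at 0, this gives Rogosinski's
   inequality: the partial sums of |b_k|^2, k >= 1, are dominated by those of (1-a^2)^2 a^(2k-2).
   By Abel summation the inequality extends to nonincreasing weights; the weights (n+1) rho^n with
   rho = s/(s+1) increase up to n = [s] and decrease afterwards, so they can be replaced by
   nonincreasing ones at the cost of the factor ([s]+1)/2 rho^([s]-1). Cauchy-Schwarz at the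
   radius a rho then turns the equation for s into the lower bound. The upper bound is the exact
   radius for f(z) = z (a-z)/(1-az). *)
theory Submission
  imports Defs
begin

section \<open>Coefficients of products with functions bounded by 1\<close>

text \<open>The vectors of powers of the \<open>M\<close>-th roots of unity are orthogonal, so the
  mixed terms of the expanded square cancel. Sampling at roots of unity stands in for integration
  over a circle.\<close>

lemma discrete_parseval:
  fixes d :: "nat \<Rightarrow> complex" and M :: nat
  assumes M: "M > 0"
  shows "(\<Sum>j<M. (cmod (\<Sum>k<M. d k * cis (2 * pi * j / M) ^ k))\<^sup>2) = M * (\<Sum>k<M. (cmod (d k))\<^sup>2)"
proof -
  define z where "z j = cis (2 * pi * real j / real M)" for j
  have orth: "(\<Sum>j<M. z j ^ k * cnj (z j ^ l)) = (if k = l then of_nat M else 0)"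
    if kl: "k < M" "l < M" for k l
  proof (cases "k = l")
    case True
    have "z j ^ k * cnj (z j ^ k) = 1" for j
      by (simp only: complex_norm_square [symmetric]) (simp add: z_def norm_power)
    then show ?thesis using True by simp
  next
    case False
    \<comment> \<open>The inner product becomes a geometric sum with ratio \<open>q\<close>; it
      vanishes because \<open>q ^ M = 1\<close> and \<open>q \<noteq> 1\<close>.\<close>
    define q where "q = cis (2 * pi * (real k - real l) / real M)"
    have "z j ^ k * cnj (z j ^ l) = q ^ j" for j
      unfolding z_def q_def Complex.DeMoivre cis_cnj cis_mult
      by (rule arg_cong [where f = cis]) (simp add: diff_divide_distrib algebra_simps)
    moreover have "q ^ M = 1"
    proof -
      have "q ^ M = cis (2 * pi * of_int (int k - int l))"
        using M by (simp add: q_def Complex.DeMoivre)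
      also have "\<dots> = 1"
        by (rule cis_multiple_2pi) auto
      finally show ?thesis .
    qed
    moreover have "q \<noteq> 1"
    proof
      assume "q = 1"
      then have "cis (2 * pi * real k / real M) = cis (2 * pi * real l / real M)"
        by (simp add: q_def right_diff_distrib diff_divide_distrib flip: cis_divide)
      moreover have "inj_on (\<lambda>j. cis (2 * pi * real j / real M)) {..<M}"
        using Complex.bij_betw_roots_unity [OF M] by (simp add: bij_betw_def)
      ultimately show False
        using kl False by (auto dest: inj_onD)
    qed
    ultimately show ?thesis
      using False by (simp add: sum_gp_strict)
  qed
  have "complex_of_real (\<Sum>j<M. (cmod (\<Sum>k<M. d k * z j ^ k))\<^sup>2)
      = (\<Sum>j<M. (\<Sum>k<M. d k * z j ^ k) * cnj (\<Sum>l<M. d l * z j ^ l))"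
    by (simp only: of_real_sum complex_norm_square)
  also have "\<dots> = (\<Sum>j<M. \<Sum>k<M. \<Sum>l<M. d k * cnj (d l) * (z j ^ k * cnj (z j ^ l)))"
    by (simp add: sum_product cnj_sum mult_ac)
  also have "\<dots> = (\<Sum>k<M. \<Sum>j<M. \<Sum>l<M. d k * cnj (d l) * (z j ^ k * cnj (z j ^ l)))"
    by (rule sum.swap)
  also have "\<dots> = (\<Sum>k<M. \<Sum>l<M. \<Sum>j<M. d k * cnj (d l) * (z j ^ k * cnj (z j ^ l)))"
    by (rule sum.cong [OF refl], rule sum.swap)
  also have "\<dots> = (\<Sum>k<M. \<Sum>l<M. d k * cnj (d l) * (if k = l then of_nat M else 0))"
    by (intro sum.cong refl) (simp only: sum_distrib_left [symmetric] orth lessThan_iff)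
  also have "\<dots> = (\<Sum>k<M. d k * cnj (d k) * of_nat M)"
    by (intro sum.cong refl) (simp add: if_distrib cong: if_cong)
  also have "\<dots> = complex_of_real (M * (\<Sum>k<M. (cmod (d k))\<^sup>2))"
    by (simp add: complex_norm_square sum_distrib_left mult_ac del: of_real_power)
  finally show ?thesis
    unfolding z_def of_real_eq_iff .
qed

text \<open>On the circle of radius \<open>r\<close> the product is pointwise no larger than the
  polynomial. Discrete Parseval at \<open>M\<close> points turns this into a comparison of
  coefficients, up to an error from the tail of the series beyond index \<open>M\<close>, which
  vanishes as \<open>M\<close> grows.\<close>

lemma bessel_circle_mult:
  fixes w :: "complex \<Rightarrow> complex" and u C :: "nat \<Rightarrow> complex"
  assumes w: "\<And>z. norm z < 1 \<Longrightarrow> norm (w z) \<le> 1"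
    and sums: "\<And>z. norm z < 1 \<Longrightarrow> (\<lambda>k. C k * z ^ k) sums (w z * (\<Sum>k\<le>n. u k * z ^ k))"
    and r: "0 < r" "r < 1"
  shows "(\<Sum>k\<le>n. (cmod (C k) * r ^ k)\<^sup>2) \<le> (\<Sum>k\<le>n. (cmod (u k) * r ^ k)\<^sup>2)"
proof -
  define P where "P z = (\<Sum>k\<le>n. u k * z ^ k)" for z
  define B where "B = (\<Sum>k\<le>n. cmod (u k))"
  define E where "E M = (\<Sum>i. cmod (C (i + M)) * r ^ (i + M))" for M
  have summ: "summable (\<lambda>k. cmod (C k) * r ^ k)"
  proof -
    \<comment> \<open>Convergence at the larger radius \<open>r'\<close> yields absolute convergence
      at \<open>r\<close>.\<close>
    obtain r' where r': "r < r'" "r' < 1" using r dense by blast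
    have "summable (\<lambda>k. C k * of_real r' ^ k)"
      using sums [of "of_real r'"] r r' by (auto simp: sums_iff)
    then have "summable (\<lambda>k. norm (C k * of_real r ^ k))"
      by (rule powser_insidea) (use r r' in auto)
    then show ?thesis using r by (simp add: norm_mult norm_power)
  qed
  have E0: "E \<longlonglongrightarrow> 0"
    unfolding E_def by (rule suminf_exist_split2 [OF summ])
  have Ege: "E M \<ge> 0" for M
    unfolding E_def using r by (intro suminf_nonneg summable_ignore_initial_segment [OF summ]) auto
  have P_le: "cmod (P z) \<le> B" if "norm z \<le> 1" for z
  proof -
    have "cmod (P z) \<le> (\<Sum>k\<le>n. cmod (u k * z ^ k))"
      unfolding P_def by (rule norm_sum)
    also have "\<dots> \<le> B"
      unfolding B_def using that
      by (intro sum_mono) (simp add: norm_mult norm_power power_le_one mult_left_le)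
    finally show ?thesis .
  qed
  have main: "(\<Sum>k\<le>n. (cmod (C k) * r ^ k)\<^sup>2)
      \<le> (\<Sum>k\<le>n. (cmod (u k) * r ^ k)\<^sup>2) + (2 * B * E M + (E M)\<^sup>2)" if M: "M > n" for M
  proof -
    define z where "z j = cis (2 * pi * real j / real M)" for j
    have nz: "norm (z j) = 1" for j by (simp add: z_def)
    define x where "x j = of_real r * z j" for j
    have nx: "norm (x j) = r" for j using r by (simp add: x_def norm_mult nz)
    have le: "(cmod (\<Sum>k<M. C k * x j ^ k))\<^sup>2 \<le> (cmod (P (x j)))\<^sup>2 + (2 * B * E M + (E M)\<^sup>2)" for j
    proof -
      have s: "(\<lambda>k. C k * x j ^ k) sums (w (x j) * P (x j))"
        unfolding P_def using sums nx r by simp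
      have "w (x j) * P (x j) = (\<Sum>i. C (i + M) * x j ^ (i + M)) + (\<Sum>k<M. C k * x j ^ k)"
        using suminf_split_initial_segment [of "\<lambda>k. C k * x j ^ k" M] s by (simp add: sums_iff)
      moreover have "cmod (\<Sum>i. C (i + M) * x j ^ (i + M)) \<le> E M"
      proof -
        have "summable (\<lambda>i. norm (C (i + M) * x j ^ (i + M)))"
          using summable_ignore_initial_segment [OF summ, of M]
          by (simp add: norm_mult norm_power nx)
        then have "cmod (\<Sum>i. C (i + M) * x j ^ (i + M)) \<le> (\<Sum>i. norm (C (i + M) * x j ^ (i + M)))"
          by (rule summable_norm)
        then show ?thesis by (simp add: E_def norm_mult norm_power nx)
      qed
      moreover have "cmod (w (x j) * P (x j)) \<le> cmod (P (x j))"
        using w [of "x j"] r by (simp add: norm_mult nx mult_right_le_one_le mult_le_cancel_right1 mult_left_le_one_le)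
      ultimately have "cmod (\<Sum>k<M. C k * x j ^ k) \<le> cmod (P (x j)) + E M"
        by (smt (verit) add_diff_cancel_left' norm_triangle_ineq4)
      then have "(cmod (\<Sum>k<M. C k * x j ^ k))\<^sup>2 \<le> (cmod (P (x j)) + E M)\<^sup>2"
        by (intro power_mono) auto
      also have "\<dots> = (cmod (P (x j)))\<^sup>2 + 2 * cmod (P (x j)) * E M + (E M)\<^sup>2"
        by (simp add: power2_eq_square algebra_simps)
      also have "\<dots> \<le> (cmod (P (x j)))\<^sup>2 + 2 * B * E M + (E M)\<^sup>2"
        using P_le [of "x j"] nx r Ege by (intro add_mono mult_right_mono) auto
      finally show ?thesis by simp
    qed
    \<comment> \<open>Padding \<open>u\<close> with zeros makes the polynomial a sum of length
      \<open>M\<close>, as Parseval demands.\<close>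
    define v where "v k = (if k \<le> n then u k else 0)" for k
    have Pv: "P y = (\<Sum>k<M. v k * y ^ k)" for y
      unfolding P_def v_def using M by (intro sum.mono_neutral_cong_left) auto
    have pars: "(\<Sum>j<M. (cmod (\<Sum>k<M. c k * x j ^ k))\<^sup>2) = M * (\<Sum>k<M. (cmod (c k) * r ^ k)\<^sup>2)" for c
      using discrete_parseval [of M "\<lambda>k. c k * of_real r ^ k"] M r
      by (simp add: x_def z_def power_mult_distrib mult_ac norm_mult norm_power)
    have "M * (\<Sum>k<M. (cmod (C k) * r ^ k)\<^sup>2) = (\<Sum>j<M. (cmod (\<Sum>k<M. C k * x j ^ k))\<^sup>2)"
      by (rule pars [symmetric])
    also have "\<dots> \<le> (\<Sum>j<M. (cmod (P (x j)))\<^sup>2 + (2 * B * E M + (E M)\<^sup>2))"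
      by (rule sum_mono [OF le])
    also have "\<dots> = M * (\<Sum>k<M. (cmod (v k) * r ^ k)\<^sup>2) + M * (2 * B * E M + (E M)\<^sup>2)"
      by (simp add: sum.distrib Pv pars)
    also have "\<dots> = M * ((\<Sum>k<M. (cmod (v k) * r ^ k)\<^sup>2) + (2 * B * E M + (E M)\<^sup>2))"
      by (simp add: algebra_simps)
    finally have "(\<Sum>k<M. (cmod (C k) * r ^ k)\<^sup>2)
        \<le> (\<Sum>k<M. (cmod (v k) * r ^ k)\<^sup>2) + (2 * B * E M + (E M)\<^sup>2)"
      using M by simp
    moreover have "(\<Sum>k<M. (cmod (v k) * r ^ k)\<^sup>2) = (\<Sum>k\<le>n. (cmod (u k) * r ^ k)\<^sup>2)"
      unfolding v_def using M by (intro sum.mono_neutral_cong_right) auto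
    moreover have "(\<Sum>k\<le>n. (cmod (C k) * r ^ k)\<^sup>2) \<le> (\<Sum>k<M. (cmod (C k) * r ^ k)\<^sup>2)"
      using M by (intro sum_mono2) auto
    ultimately show ?thesis by linarith
  qed
  have "(\<lambda>M. (\<Sum>k\<le>n. (cmod (u k) * r ^ k)\<^sup>2) + (2 * B * E M + (E M)\<^sup>2))
      \<longlonglongrightarrow> (\<Sum>k\<le>n. (cmod (u k) * r ^ k)\<^sup>2) + (2 * B * 0 + 0\<^sup>2)"
    by (intro tendsto_intros E0)
  then have "(\<lambda>M. (\<Sum>k\<le>n. (cmod (u k) * r ^ k)\<^sup>2) + (2 * B * E M + (E M)\<^sup>2))
      \<longlonglongrightarrow> (\<Sum>k\<le>n. (cmod (u k) * r ^ k)\<^sup>2)" by simp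
  then show ?thesis
    by (rule tendsto_lowerbound) (use main in \<open>auto intro: eventually_mono [OF eventually_gt_at_top [of n]]\<close>)
qed

text \<open>Up to index \<open>n\<close> the product depends only on the coefficients of
  \<open>U\<close> up to \<open>n\<close>, so \<open>U\<close>, which may diverge, can be truncated
  to a polynomial. The bound on circles of radius \<open>r\<close> then passes to the limit
  \<open>r = 1\<close>.\<close>

lemma fps_mult_contraction:
  fixes w :: "complex \<Rightarrow> complex" and W U :: "complex fps"
  assumes hol: "w holomorphic_on ball 0 1"
    and w: "\<And>z. norm z < 1 \<Longrightarrow> norm (w z) \<le> 1"
    and W: "w has_fps_expansion W"
  shows "(\<Sum>k\<le>n. (cmod (fps_nth (W * U) k))\<^sup>2) \<le> (\<Sum>k\<le>n. (cmod (fps_nth U k))\<^sup>2)"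
proof -
  define u where "u = fps_nth U"
  define V where "V = Abs_fps (\<lambda>k. if k \<le> n then u k else 0)"
  define C where "C = fps_nth (W * V)"
  have CU: "fps_nth (W * U) k = C k" if "k \<le> n" for k
    using that by (auto simp: C_def fps_mult_nth V_def u_def intro!: sum.cong)
  have V: "(\<lambda>z. \<Sum>k\<le>n. u k * z ^ k) has_fps_expansion V"
  proof (rule has_fps_expansionI, rule always_eventually, rule allI)
    fix z :: complex
    have "(\<lambda>k. if k \<in> {..n} then u k * z ^ k else 0) sums (\<Sum>k\<le>n. u k * z ^ k)"
      by (rule sums_If_finite_set) auto
    moreover have "(\<lambda>k. if k \<in> {..n} then u k * z ^ k else 0) = (\<lambda>k. fps_nth V k * z ^ k)"
      by (auto simp: V_def)
    ultimately show "(\<lambda>k. fps_nth V k * z ^ k) sums (\<Sum>k\<le>n. u k * z ^ k)" by simp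
  qed
  have sums: "(\<lambda>k. C k * z ^ k) sums (w z * (\<Sum>k\<le>n. u k * z ^ k))" if "norm z < 1" for z
    unfolding C_def
    by (rule has_fps_expansion_imp_sums_complex [where r = 1])
       (use that hol in \<open>auto intro!: has_fps_expansion_mult W V holomorphic_intros simp: one_ereal_def\<close>)
  have le: "(\<Sum>k\<le>n. (cmod (C k) * r ^ k)\<^sup>2) \<le> (\<Sum>k\<le>n. (cmod (u k) * r ^ k)\<^sup>2)" if "0 < r" "r < 1" for r
    by (rule bessel_circle_mult [OF w sums that])
  have lim: "((\<lambda>r. (\<Sum>k\<le>n. (cmod (c k) * r ^ k)\<^sup>2)) \<longlongrightarrow> (\<Sum>k\<le>n. (cmod (c k))\<^sup>2)) (at_left (1::real))"
    for c :: "nat \<Rightarrow> complex"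
  proof -
    have "((\<lambda>r. (\<Sum>k\<le>n. (cmod (c k) * r ^ k)\<^sup>2)) \<longlongrightarrow> (\<Sum>k\<le>n. (cmod (c k) * 1 ^ k)\<^sup>2)) (at_left (1::real))"
      by (intro tendsto_intros)
    then show ?thesis by simp
  qed
  have "(\<Sum>k\<le>n. (cmod (C k))\<^sup>2) \<le> (\<Sum>k\<le>n. (cmod (u k))\<^sup>2)"
  proof (rule tendsto_le [OF _ lim lim])
    have "eventually (\<lambda>r::real. r \<in> {0<..<1}) (at_left 1)"
      by (rule eventually_at_leftI [of 0]) auto
    then show "eventually (\<lambda>r. (\<Sum>k\<le>n. (cmod (C k) * r ^ k)\<^sup>2) \<le> (\<Sum>k\<le>n. (cmod (u k) * r ^ k)\<^sup>2)) (at_left (1::real))"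
      by eventually_elim (use le in auto)
  qed simp
  then show ?thesis
    by (simp add: CU u_def)
qed

section \<open>Moebius transforms and Rogosinski's inequality\<close>

text \<open>Rests on the identity
  \<open>|1 - cnj w * z|^2 - |z - w|^2 = (1 - |w|^2) * (1 - |z|^2)\<close>.\<close>

lemma norm_moebius_le_1:
  fixes w z :: complex
  assumes "norm w < 1" "norm z \<le> 1"
  shows "norm ((z - w) / (1 - cnj w * z)) \<le> 1" and "1 - cnj w * z \<noteq> 0"
proof -
  have "norm (cnj w * z) < 1"
    using assms by (simp add: norm_mult) (metis mult_left_le norm_ge_zero order.strict_trans1)
  then show nz: "1 - cnj w * z \<noteq> 0" by auto
  have "complex_of_real ((norm (1 - cnj w * z))\<^sup>2 - (norm (z - w))\<^sup>2)
      = complex_of_real ((1 - (norm w)\<^sup>2) * (1 - (norm z)\<^sup>2))"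
    by (simp only: of_real_diff of_real_mult of_real_1 complex_norm_square) (simp add: algebra_simps)
  then have "(norm (1 - cnj w * z))\<^sup>2 - (norm (z - w))\<^sup>2 = (1 - (norm w)\<^sup>2) * (1 - (norm z)\<^sup>2)"
    unfolding of_real_eq_iff .
  moreover have "\<dots> \<ge> 0"
    using assms by (intro mult_nonneg_nonneg) (auto simp: abs_square_le_1 power_le_one)
  ultimately have "(norm (z - w))\<^sup>2 \<le> (norm (1 - cnj w * z))\<^sup>2" by linarith
  then have "norm (z - w) \<le> norm (1 - cnj w * z)"
    by (rule power2_le_imp_le) simp
  then show "norm ((z - w) / (1 - cnj w * z)) \<le> 1"
    using nz by (simp add: norm_divide)
qed

text \<open>With the Moebius transform \<open>w\<close> of \<open>g\<close> one has \<open>g - b 0 = w * (1 - cnj (b 0) * g)\<close>. Since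
  \<open>w 0 = 0\<close>, the coefficients of the left-hand side up to \<open>Suc n\<close> involve those of the
  second factor only up to \<open>n\<close>, and the contraction property of \<open>w\<close> yields the recursion
  \<open>S (Suc n) \<le> (1 - a\<^sup>2)\<^sup>2 + a\<^sup>2 * S n\<close> for the left-hand sides \<open>S n\<close>.\<close>
lemma rogosinski_coeff_bound:
  fixes g :: "complex \<Rightarrow> complex" and b :: "nat \<Rightarrow> complex"
  assumes sums: "\<And>z. norm z < 1 \<Longrightarrow> (\<lambda>n. b n * z ^ n) sums g z"
    and g: "\<And>z. norm z < 1 \<Longrightarrow> norm (g z) \<le> 1"
    and b0: "norm (b 0) < 1"
  shows "(\<Sum>k=1..n. (cmod (b k))\<^sup>2) \<le> (\<Sum>k=1..n. (1 - (cmod (b 0))\<^sup>2)\<^sup>2 * ((cmod (b 0))\<^sup>2) ^ (k - 1))"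
proof (induction n)
  case (Suc n)
  define G where "G = Abs_fps b"
  define w where "w z = (g z - b 0) / (1 - cnj (b 0) * g z)" for z
  define U where "U = 1 - fps_const (cnj (b 0)) * G"
  have hol: "g holomorphic_on ball 0 1"
    by (rule power_series_holomorphic) (use sums in auto)
  have G: "g has_fps_expansion G"
    unfolding G_def
    by (rule has_fps_expansionI, rule eventually_mono [OF eventually_nhds_in_open [of "ball 0 1"]])
       (use sums in auto)
  have nz: "1 - cnj (b 0) * g z \<noteq> 0" if "norm z < 1" for z
    using norm_moebius_le_1 [OF b0 g [OF that]] by simp
  have hw: "w holomorphic_on ball 0 1"
    unfolding w_def by (intro holomorphic_intros hol) (use nz in auto)
  have w_le: "norm (w z) \<le> 1" if "norm z < 1" for z
    unfolding w_def by (rule norm_moebius_le_1 [OF b0 g [OF that]])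
  define W where "W = fps_expansion w 0"
  have W: "w has_fps_expansion W"
    unfolding W_def by (rule has_fps_expansion_fps_expansion [of "ball 0 1"]) (use hw in auto)
  have "g 0 = b 0"
    using sums [of 0] by (simp add: powser_sums_zero_iff)
  then have W0: "fps_nth W 0 = 0"
    using has_fps_expansion_imp_0_eq_fps_nth_0 [OF W] by (simp add: w_def)
  have U: "(\<lambda>z. 1 - cnj (b 0) * g z) has_fps_expansion U"
    unfolding U_def by (intro fps_expansion_intros G)
  have WU: "W * U = G - fps_const (b 0)"
  proof (rule fps_expansion_unique_complex)
    show "(\<lambda>z. g z - b 0) has_fps_expansion G - fps_const (b 0)"
      by (intro fps_expansion_intros G)
    have "(\<lambda>z. w z * (1 - cnj (b 0) * g z)) has_fps_expansion W * U"
      by (intro fps_expansion_intros W U)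
    moreover have "eventually (\<lambda>z. w z * (1 - cnj (b 0) * g z) = g z - b 0) (nhds 0)"
      by (rule eventually_mono [OF eventually_nhds_in_open [of "ball 0 1"]])
         (use nz in \<open>auto simp: w_def\<close>)
    ultimately show "(\<lambda>z. g z - b 0) has_fps_expansion W * U"
      by (subst (asm) has_fps_expansion_cong) auto
  qed
  define V where "V = Abs_fps (\<lambda>k. if k \<le> n then fps_nth U k else 0)"
  have WV: "fps_nth (W * V) k = (if k = 0 then 0 else b k)" if "k \<le> Suc n" for k
  proof -
    have "fps_nth (W * V) k = fps_nth (W * U) k"
      unfolding fps_mult_nth
    proof (intro sum.cong refl)
      fix i assume "i \<in> {0..k}"
      then show "fps_nth W i * fps_nth V (k - i) = fps_nth W i * fps_nth U (k - i)"
        using W0 that by (cases "i = 0") (auto simp: V_def)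
    qed
    then show ?thesis by (simp add: WU G_def)
  qed
  let ?a = "(cmod (b 0))\<^sup>2"
  have a: "?a \<ge> 0" "?a < 1" using b0 by (auto simp: abs_square_less_1)
  \<comment> \<open>The constant coefficient produces the term
    \<open>(1 - a\<^sup>2)\<^sup>2\<close> of the recursion, the others its factor
    \<open>a\<^sup>2\<close>.\<close>
  have U_nth: "fps_nth U k = (if k = 0 then of_real (1 - ?a) else - (cnj (b 0) * b k))" for k
    unfolding of_real_diff of_real_1 complex_norm_square by (simp add: U_def G_def mult.commute)
  have "(\<Sum>k=1..Suc n. (cmod (b k))\<^sup>2) = (\<Sum>k\<le>Suc n. (cmod (fps_nth (W * V) k))\<^sup>2)"
    by (intro sum.mono_neutral_cong_left) (auto simp: WV)
  also have "\<dots> \<le> (\<Sum>k\<le>Suc n. (cmod (fps_nth V k))\<^sup>2)"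
    by (rule fps_mult_contraction [OF hw w_le W])
  also have "\<dots> = (\<Sum>k\<le>n. (cmod (fps_nth U k))\<^sup>2)"
    by (intro sum.mono_neutral_cong_right) (auto simp: V_def)
  also have "\<dots> = (1 - ?a)\<^sup>2 + ?a * (\<Sum>k=1..n. (cmod (b k))\<^sup>2)"
  proof -
    have "{..n} = insert 0 {1..n}" by auto
    moreover have "cmod (1 - (of_real (cmod (b 0)))\<^sup>2) = \<bar>1 - ?a\<bar>"
      by (metis norm_of_real of_real_1 of_real_diff of_real_power)
    ultimately show ?thesis
      by (simp add: U_nth norm_mult power_mult_distrib sum_distrib_left)
  qed
  also have "\<dots> \<le> (1 - ?a)\<^sup>2 + ?a * (\<Sum>k=1..n. (1 - ?a)\<^sup>2 * ?a ^ (k - 1))"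
    using Suc a by (intro add_left_mono mult_left_mono) auto
  also have "\<dots> = (\<Sum>k=1..Suc n. (1 - ?a)\<^sup>2 * ?a ^ (k - 1))"
  proof -
    have "?a * (\<Sum>k=1..n. (1 - ?a)\<^sup>2 * ?a ^ (k - 1)) = (\<Sum>k=1..n. (1 - ?a)\<^sup>2 * ?a ^ k)"
      unfolding sum_distrib_left by (intro sum.cong refl) (auto simp: power_eq_if)
    moreover have "(\<Sum>k=1..Suc n. (1 - ?a)\<^sup>2 * ?a ^ (k - 1)) = (\<Sum>k=0..n. (1 - ?a)\<^sup>2 * ?a ^ k)"
      using sum.shift_bounds_cl_Suc_ivl [of "\<lambda>k. (1 - ?a)\<^sup>2 * ?a ^ (k - 1)" 0 n] by simp
    ultimately show ?thesis
      by (simp add: sum.atLeast_Suc_atMost [of 0])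
  qed
  finally show ?case .
qed auto

text \<open>\<open>Schwarz_Lemma\<close> asks for a strict bound by 1, so it is applied to
  \<open>t * f\<close> with \<open>t < 1\<close>, and \<open>t\<close> then tends to 1.\<close>

lemma schwarz_power_series:
  fixes f :: "complex \<Rightarrow> complex" and c :: "nat \<Rightarrow> complex"
  assumes sums: "\<And>z. norm z < 1 \<Longrightarrow> (\<lambda>n. c (Suc n) * z ^ Suc n) sums f z"
    and f: "\<And>z. norm z < 1 \<Longrightarrow> norm (f z) \<le> 1"
    and hol: "f holomorphic_on ball 0 1"
    and z: "norm z < 1"
  shows "norm (f z) \<le> norm z"
proof -
  have "f 0 = 0" using sums [of 0] by (simp add: sums_iff)
  have le: "t * norm (f z) \<le> norm z" if t: "0 < t" "t < 1" for t
  proof -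
    have "norm (of_real t * f x) < 1" if "norm x < 1" for x
    proof -
      have "t * norm (f x) \<le> t"
        using f [OF that] t by (intro mult_left_le) auto
      moreover have "norm (of_real t * f x) = t * norm (f x)"
        using t by (simp add: norm_mult)
      ultimately show ?thesis using t by linarith
    qed
    then have "norm (of_real t * f z) \<le> norm z"
      by (intro Schwarz_Lemma(1)) (use hol \<open>f 0 = 0\<close> z in \<open>auto intro!: holomorphic_intros\<close>)
    then show ?thesis using t by (simp add: norm_mult)
  qed
  show ?thesis
  proof (rule tendsto_upperbound [of "\<lambda>t. t * norm (f z)" _ "at_left 1"])
    show "((\<lambda>t. t * norm (f z)) \<longlongrightarrow> norm (f z)) (at_left 1)"
      by (rule tendsto_eq_intros refl)+ simp
    show "eventually (\<lambda>t. t * norm (f z) \<le> norm z) (at_left 1)"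
      by (rule eventually_at_leftI [of 0]) (use le in auto)
  qed simp
qed

text \<open>The quotient \<open>f z / z\<close>, completed by \<open>c 1\<close> at the origin, has
  the shifted coefficients and is bounded by 1 by the Schwarz lemma, so Rogosinski's inequality
  applies to it.\<close>

lemma rogosinski_coeff_bound_zero:
  fixes f :: "complex \<Rightarrow> complex" and c :: "nat \<Rightarrow> complex"
  assumes sums: "\<And>z. norm z < 1 \<Longrightarrow> (\<lambda>n. c (Suc n) * z ^ Suc n) sums f z"
    and f: "\<And>z. norm z < 1 \<Longrightarrow> norm (f z) \<le> 1"
    and hol: "f holomorphic_on ball 0 1"
    and a: "norm (c 1) = a" "a < 1"
  shows "(\<Sum>k=1..n. (cmod (c (Suc k)))\<^sup>2) \<le> (\<Sum>k=1..n. (1 - a\<^sup>2)\<^sup>2 * (a\<^sup>2) ^ (k - 1))"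
proof -
  define g where "g z = (if z = 0 then c 1 else f z / z)" for z
  have "(\<Sum>k=1..n. (cmod (c (Suc k)))\<^sup>2)
      \<le> (\<Sum>k=1..n. (1 - (cmod (c (Suc 0)))\<^sup>2)\<^sup>2 * ((cmod (c (Suc 0)))\<^sup>2) ^ (k - 1))"
  proof (rule rogosinski_coeff_bound [where b = "\<lambda>k. c (Suc k)" and g = g])
    fix z :: complex assume z: "norm z < 1"
    show "(\<lambda>n. c (Suc n) * z ^ n) sums g z"
    proof (cases "z = 0")
      case True
      then show ?thesis
        using powser_sums_zero [of "\<lambda>n. c (Suc n)"] by (simp add: g_def)
    next
      case False
      then show ?thesis
        using sums_divide [OF sums [OF z], of z] by (simp add: g_def)
    qed
    show "norm (g z) \<le> 1"
      using schwarz_power_series [OF sums f hol z] a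
      by (auto simp: g_def norm_divide divide_simps)
  qed (use a in simp)
  then show ?thesis using a by simp
qed

section \<open>The weights and their peak\<close>

text \<open>The base \<open>s / (s + 1)\<close> makes the ratio of the weights at
  \<open>n + 1\<close> and \<open>n\<close> at least 1 exactly when \<open>n + 1 \<le> s\<close>
  (for \<open>s > 0\<close>), which places the maximum at the integer part of
  \<open>s\<close>.\<close>

definition bohr_weight :: "real \<Rightarrow> nat \<Rightarrow> real" where
  "bohr_weight s n = real (n + 1) * (s / (s + 1)) ^ n"

text \<open>The maximum of \<open>bohr_weight s n / bohr_weight s 1\<close> over \<open>n \<ge> 1\<close>, attained at the floor of \<open>s\<close>;
  this is why the expression with floors is continuous and increasing in \<open>s\<close>.\<close>
definition bohr_peak :: "real \<Rightarrow> real" where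
  "bohr_peak s = (of_int \<lfloor>s\<rfloor> + 1) / 2 * (s / (s + 1)) powi (\<lfloor>s\<rfloor> - 1)"

lemma bohr_weight_mono:
  assumes "s \<ge> 0" "i \<le> j" "real j \<le> s"
  shows "bohr_weight s i \<le> bohr_weight s j"
  using assms(2,3)
proof (induction j rule: dec_induct)
  case (step n)
  have "real (n + 1) * (s + 1) \<le> real (n + 2) * s"
    using step.prems by (simp add: algebra_simps)
  then have "real (n + 1) \<le> real (n + 2) * (s / (s + 1))"
    using assms(1) by (simp add: field_simps)
  then have "real (n + 1) * (s / (s + 1)) ^ n \<le> real (n + 2) * (s / (s + 1)) * (s / (s + 1)) ^ n"
    using assms(1) by (intro mult_right_mono) auto
  then have "bohr_weight s n \<le> bohr_weight s (Suc n)"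
    by (simp add: bohr_weight_def mult_ac)
  with step show ?case by simp
qed simp

lemma bohr_weight_antimono:
  assumes "s \<ge> 0" "i \<le> j" "s \<le> real i + 1"
  shows "bohr_weight s j \<le> bohr_weight s i"
  using assms(2)
proof (induction j rule: dec_induct)
  case (step n)
  have "real (n + 2) * s \<le> real (n + 1) * (s + 1)"
    using step.hyps assms(3) by (simp add: algebra_simps)
  then have "real (n + 2) * (s / (s + 1)) \<le> real (n + 1)"
    using assms(1) by (simp add: field_simps)
  then have "real (n + 2) * (s / (s + 1)) * (s / (s + 1)) ^ n \<le> real (n + 1) * (s / (s + 1)) ^ n"
    using assms(1) by (intro mult_right_mono) auto
  then have "bohr_weight s (Suc n) \<le> bohr_weight s n"
    by (simp add: bohr_weight_def mult_ac)
  with step show ?case by simp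
qed simp

lemma bohr_weight_le_floor:
  assumes "s \<ge> 0"
  shows "bohr_weight s n \<le> bohr_weight s (nat \<lfloor>s\<rfloor>)"
proof (cases "n \<le> nat \<lfloor>s\<rfloor>")
  case True
  then show ?thesis using assms by (intro bohr_weight_mono) (auto simp: of_nat_nat)
next
  case False
  then show ?thesis using assms by (intro bohr_weight_antimono) linarith+
qed

lemma bohr_peak_eq_weight:
  assumes "s \<ge> 1"
  shows "bohr_weight s (nat \<lfloor>s\<rfloor>) = bohr_peak s * bohr_weight s 1"
proof -
  have "nat \<lfloor>s\<rfloor> \<ge> 1" using assms by linarith
  then obtain m where m: "nat \<lfloor>s\<rfloor> = Suc m" by (cases "nat \<lfloor>s\<rfloor>") auto
  then have "\<lfloor>s\<rfloor> = int m + 1" using assms by linarith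
  then show ?thesis
    by (simp add: bohr_weight_def bohr_peak_def nat_add_distrib)
qed

text \<open>Seen as the upper envelope of these floor-free branches, the peak can be bounded below
  by any one of them; its monotonicity and growth follow from this.\<close>

lemma bohr_peak_ge:
  assumes "s \<ge> 1"
  shows "real (k + 2) / 2 * (s / (s + 1)) ^ k \<le> bohr_peak s"
proof -
  have "bohr_weight s (Suc k) \<le> bohr_peak s * bohr_weight s 1"
    using bohr_weight_le_floor [of s "Suc k"] assms by (simp add: bohr_peak_eq_weight)
  moreover have "bohr_weight s (Suc k) = (real (k + 2) / 2 * (s / (s + 1)) ^ k) * bohr_weight s 1"
    by (simp add: bohr_weight_def)
  moreover have "bohr_weight s 1 > 0" using assms by (simp add: bohr_weight_def)
  ultimately show ?thesis by simp
qed

lemma bohr_peak_ge_1: "s \<ge> 1 \<Longrightarrow> bohr_peak s \<ge> 1"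
  using bohr_peak_ge [of s 0] by simp

lemma bohr_peak_attained:
  assumes "real (Suc k) \<le> s" "s < real (Suc k) + 1"
  shows "bohr_peak s = real (k + 2) / 2 * (s / (s + 1)) ^ k"
proof -
  have "\<lfloor>s\<rfloor> = int (Suc k)" using assms by linarith
  then show ?thesis by (simp add: bohr_peak_def)
qed

text \<open>At the right endpoint \<open>s = k + 2\<close> the next branch takes over with the same
  value, since \<open>(k + 3) * (s / (s + 1)) = k + 2\<close>. So the peak is continuous across
  integers despite the floor.\<close>

lemma bohr_peak_attained_closed:
  assumes "real (Suc k) \<le> s" "s \<le> real (Suc k) + 1"
  shows "bohr_peak s = real (k + 2) / 2 * (s / (s + 1)) ^ k"
proof (cases "s < real (Suc k) + 1")
  case False
  then have s: "s = real (k + 2)" using assms by simp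
  define q where "q = s / (s + 1)"
  then have "bohr_peak s = real (k + 3) / 2 * (s / (s + 1)) ^ Suc k"
    by (subst bohr_peak_attained [of "Suc k"]) (simp_all add: s)
  also have "\<dots> = (real (k + 3) * (s / (s + 1))) / 2 * (s / (s + 1)) ^ k" unfolding q_def [symmetric] by simp
  also have "real (k + 3) * (s / (s + 1)) = real (k + 2)" by (simp add: s divide_simps)
  finally show ?thesis .
qed (use assms bohr_peak_attained in blast)

text \<open>The branch attained at \<open>s\<close> grows with its argument, and at \<open>t\<close>
  it is still below the peak.\<close>

lemma bohr_peak_mono:
  assumes "1 \<le> s" "s \<le> t"
  shows "bohr_peak s \<le> bohr_peak t"
proof -
  define k where "k = nat \<lfloor>s\<rfloor> - 1"
  have k: "real (Suc k) \<le> s" "s < real (Suc k) + 1"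
    using assms unfolding k_def by linarith+
  have "s / (s + 1) \<le> t / (t + 1)" using assms by (simp add: field_simps)
  then have "bohr_peak s \<le> real (k + 2) / 2 * (t / (t + 1)) ^ k"
    unfolding bohr_peak_attained [OF k] using assms by (intro mult_left_mono power_mono) auto
  also have "\<dots> \<le> bohr_peak t" using assms by (intro bohr_peak_ge) auto
  finally show ?thesis .
qed

text \<open>Gives unboundedness of the peak; the power is bounded below through
  \<open>(1 + 1 / (k + 1)) ^ k \<le> exp 1\<close>.\<close>

lemma bohr_peak_nat_ge: "bohr_peak (real (Suc k)) \<ge> real k / (2 * exp 1)"
proof -
  have "(1 + 1 / real (Suc k)) ^ k \<le> exp (1 / real (Suc k)) ^ k"
    by (intro power_mono exp_ge_add_one_self) auto
  also have "\<dots> = exp (real k / real (Suc k))" by (simp flip: exp_of_nat_mult)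
  also have "\<dots> \<le> exp 1" by simp
  finally have le: "(1 + 1 / real (Suc k)) ^ k \<le> exp 1" .
  have eq: "real (Suc k) / (real (Suc k) + 1) = inverse (1 + 1 / real (Suc k))"
    by (simp add: field_simps)
  have "inverse (exp 1) \<le> inverse ((1 + 1 / real (Suc k)) ^ k)"
    using le by (intro le_imp_inverse_le) (auto intro!: zero_less_power add_pos_pos)
  then have "inverse (exp 1) \<le> (real (Suc k) / (real (Suc k) + 1)) ^ k"
    unfolding eq by (simp only: power_inverse)
  then have "real k / 2 * inverse (exp 1) \<le> real (k + 2) / 2 * (real (Suc k) / (real (Suc k) + 1)) ^ k"
    by (intro mult_mono) auto
  also have "\<dots> \<le> bohr_peak (real (Suc k))" by (rule bohr_peak_ge) simp
  finally show ?thesis by (simp add: field_simps)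
qed

section \<open>Solvability of the equation for \<open>s\<close>\<close>

text \<open>For \<open>0 < a < 1\<close> and \<open>t > 0\<close>, the second factor is the sum of
  \<open>(n + 1) * x ^ n\<close> over \<open>n \<ge> 1\<close> at
  \<open>x = a\<^sup>2 * (t / (t + 1))\<close>.\<close>

definition bohr_lhs :: "real \<Rightarrow> real \<Rightarrow> real" where
  "bohr_lhs a t = sqrt (bohr_peak t) * (1 / (1 - a\<^sup>2 * (t / (t + 1)))\<^sup>2 - 1)"

lemma bohr_ratio_bounds:
  fixes a t :: real
  assumes "0 < a" "a < 1" "0 < t"
  shows "0 < a\<^sup>2 * (t / (t + 1))" "a\<^sup>2 * (t / (t + 1)) < 1"
proof -
  show "0 < a\<^sup>2 * (t / (t + 1))" using assms by simp
  have "a\<^sup>2 * (t / (t + 1)) < 1 * 1"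
    using assms by (intro mult_strict_mono) (auto simp: abs_square_less_1)
  then show "a\<^sup>2 * (t / (t + 1)) < 1" by simp
qed

lemma inverse_square_minus_one_strict_mono:
  fixes x y :: real
  assumes "x < y" "y < 1"
  shows "1 / (1 - x)\<^sup>2 - 1 < 1 / (1 - y)\<^sup>2 - 1"
  using assms by (auto intro!: divide_strict_left_mono power_strict_mono)

lemma bohr_lhs_strict_mono:
  assumes a: "0 < a" "a < 1" and "1 \<le> s" "s < t"
  shows "bohr_lhs a s < bohr_lhs a t"
proof -
  have "s / (s + 1) < t / (t + 1)" using assms by (simp add: field_simps)
  then have "1 / (1 - a\<^sup>2 * (s / (s + 1)))\<^sup>2 - 1 < 1 / (1 - a\<^sup>2 * (t / (t + 1)))\<^sup>2 - 1"
    using a assms bohr_ratio_bounds [of a t]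
    by (intro inverse_square_minus_one_strict_mono mult_strict_left_mono) auto
  moreover have "0 < 1 / (1 - a\<^sup>2 * (s / (s + 1)))\<^sup>2 - 1"
    using inverse_square_minus_one_strict_mono [of 0 "a\<^sup>2 * (s / (s + 1))"] bohr_ratio_bounds [of a s] assms
    by simp
  moreover have "sqrt (bohr_peak s) \<le> sqrt (bohr_peak t)"
    using assms by (simp add: bohr_peak_mono)
  moreover have "sqrt (bohr_peak s) > 0"
    using bohr_peak_ge_1 [of s] assms by simp
  ultimately show ?thesis
    unfolding bohr_lhs_def by (intro mult_le_less_imp_less) auto
qed

text \<open>The function is unbounded because the peak is, so \<open>c\<close> lies between its
  values at two consecutive integers. There a single branch of the peak is in force and the
  intermediate value theorem applies; strict monotonicity gives uniqueness.\<close>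

lemma bohr_lhs_unique_solution:
  assumes a: "0 < a" "a < 1" and c: "bohr_lhs a 1 \<le> c"
  shows "\<exists>s. {t \<in> {1..}. bohr_lhs a t = c} = {s}"
proof -
  \<comment> \<open>The value of the second factor at \<open>t = 1\<close>, a lower bound for it at
    the integers \<open>Suc n\<close>; once the peak exceeds \<open>C\<close>, the product exceeds
    \<open>c\<close>.\<close>
  define d where "d = 1 / (1 - a\<^sup>2 * (1 / 2))\<^sup>2 - 1"
  have d: "d > 0"
    using inverse_square_minus_one_strict_mono [of 0 "a\<^sup>2 / 2"] bohr_ratio_bounds [of a 1] a
    by (simp add: d_def)
  define C where "C = (c / d)\<^sup>2"
  obtain n where n: "real n > 2 * exp 1 * C" using reals_Archimedean2 by blast
  have "c < bohr_lhs a (real (Suc n))"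
  proof -
    have "C < real n / (2 * exp 1)" using n by (simp add: field_simps)
    then have "C < bohr_peak (real (Suc n))" using bohr_peak_nat_ge [of n] by linarith
    then have "\<bar>c / d\<bar> < sqrt (bohr_peak (real (Suc n)))"
      unfolding C_def using real_sqrt_less_mono by fastforce
    then have "c < sqrt (bohr_peak (real (Suc n))) * d"
      using d by (simp add: abs_less_iff field_simps)
    also have "\<dots> \<le> bohr_lhs a (real (Suc n))"
    proof -
      have "1 / 2 \<le> real (Suc n) / (real (Suc n) + 1)" by (simp add: field_simps)
      then have "d \<le> 1 / (1 - a\<^sup>2 * (real (Suc n) / (real (Suc n) + 1)))\<^sup>2 - 1"
        unfolding d_def using bohr_ratio_bounds [of a "real (Suc n)"] bohr_ratio_bounds [of a 1] a
        by (intro diff_right_mono divide_left_mono power_mono diff_left_mono mult_left_mono mult_pos_pos zero_less_power) auto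
      then show ?thesis
        unfolding bohr_lhs_def using bohr_peak_ge_1 [of "real (Suc n)"]
        by (intro mult_left_mono) auto
    qed
    finally show ?thesis .
  qed
  then have ex: "\<exists>n. c < bohr_lhs a (real (Suc n))" by blast
  \<comment> \<open>The first integer at which \<open>c\<close> is exceeded; by the hypothesis at 1
    it has a predecessor with value at most \<open>c\<close>.\<close>
  define N where "N = (LEAST n. c < bohr_lhs a (real (Suc n)))"
  have N: "c < bohr_lhs a (real (Suc N))"
    unfolding N_def by (rule LeastI_ex [OF ex])
  have "N \<noteq> 0" using N c by (intro notI) simp
  then obtain k where k: "N = Suc k" using not0_implies_Suc by blast
  have le: "bohr_lhs a (real (Suc k)) \<le> c"
    using not_less_Least [of k "\<lambda>n. c < bohr_lhs a (real (Suc n))"] k unfolding N_def by linarith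
  define h where "h t = sqrt (real (k + 2) / 2 * (t / (t + 1)) ^ k)
      * (1 / (1 - a\<^sup>2 * (t / (t + 1)))\<^sup>2 - 1)" for t
  have h: "h t = bohr_lhs a t" if "real (Suc k) \<le> t" "t \<le> real (Suc k) + 1" for t
    by (simp add: h_def bohr_lhs_def bohr_peak_attained_closed [OF that])
  have "\<exists>t\<ge>real (Suc k). t \<le> real (Suc k) + 1 \<and> h t = c"
  proof (rule IVT')
    show "continuous_on {real (Suc k)..real (Suc k) + 1} h"
      unfolding h_def
    proof (intro continuous_intros ballI)
      fix t assume t: "t \<in> {real (Suc k)..real (Suc k) + 1}"
      then show "t + 1 \<noteq> 0" by auto
      show "(1 - a\<^sup>2 * (t / (t + 1)))\<^sup>2 \<noteq> 0"
        using bohr_ratio_bounds [of a t] a t by auto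
    qed auto
  qed (use h le N k in \<open>auto simp: add_ac\<close>)
  then obtain s where s: "s \<ge> real (Suc k)" "s \<le> real (Suc k) + 1" "h s = c" by blast
  then have "bohr_lhs a s = c" "s \<ge> 1" using h by auto
  moreover have "t = s" if "t \<ge> 1" "bohr_lhs a t = c" for t
    using bohr_lhs_strict_mono [OF a, of s t] bohr_lhs_strict_mono [OF a, of t s] that calculation
    by (cases t s rule: linorder_cases) auto
  ultimately have "{t \<in> {1..}. bohr_lhs a t = c} = {s}" by fastforce
  then show ?thesis by blast
qed

section \<open>Weighted sums and the lower bound\<close>

text \<open>Abel summation in inductive form: the boundary term \<open>l n * D n\<close>, which is
  nonnegative, bounds the weighted difference from below.\<close>

lemma sum_antimono_weights_le:
  fixes l x y :: "nat \<Rightarrow> real"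
  assumes l: "\<And>n. l (Suc n) \<le> l n" "\<And>n. l n \<ge> 0"
    and le: "\<And>n. (\<Sum>k=1..n. x k) \<le> (\<Sum>k=1..n. y k)"
  shows "(\<Sum>k=1..n. l k * x k) \<le> (\<Sum>k=1..n. l k * y k)"
proof -
  define D where "D n = (\<Sum>k=1..n. y k - x k)" for n
  have D: "D n \<ge> 0" for n using le [of n] by (simp add: D_def sum_subtractf)
  have "l n * D n \<le> (\<Sum>k=1..n. l k * (y k - x k))"
  proof (induction n)
    case (Suc n)
    have "l (Suc n) * D n \<le> l n * D n"
      using l(1) D by (intro mult_right_mono)
    then have "l (Suc n) * D (Suc n) \<le> l n * D n + l (Suc n) * (y (Suc n) - x (Suc n))"
      by (simp add: D_def algebra_simps)
    then show ?case using Suc by simp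
  qed (simp add: D_def)
  moreover have "l n * D n \<ge> 0" using l D by simp
  ultimately have "0 \<le> (\<Sum>k=1..n. l k * (y k - x k))" by linarith
  then show ?thesis by (simp add: right_diff_distrib sum_subtractf)
qed

text \<open>The weights are not monotone, but levelling them up to their maximum for indices below the
  floor of \<open>s\<close> makes them so, at the cost of a factor of at most \<open>bohr_peak s\<close>.\<close>
lemma sum_bohr_weight_le:
  fixes x y :: "nat \<Rightarrow> real"
  assumes s: "s \<ge> 1"
    and x: "\<And>n. x n \<ge> 0" and y: "\<And>n. y n \<ge> 0"
    and le: "\<And>n. (\<Sum>k=1..n. x k) \<le> (\<Sum>k=1..n. y k)"
  shows "(\<Sum>k=1..n. bohr_weight s k * x k) \<le> bohr_peak s * (\<Sum>k=1..n. bohr_weight s k * y k)"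
proof -
  define m where "m = nat \<lfloor>s\<rfloor>"
  define l where "l n = bohr_weight s (max m n)" for n
  have m: "real m \<le> s" "s \<le> real m + 1" unfolding m_def using s by linarith+
  have w_le: "bohr_weight s k \<le> l k" for k
    unfolding l_def using bohr_weight_le_floor [of s k] s by (simp add: max_def m_def)
  have l_le: "l k \<le> bohr_peak s * bohr_weight s k" if "k \<ge> 1" for k
  proof (cases "k \<le> m")
    case True
    then have "l k = bohr_peak s * bohr_weight s 1"
      using bohr_peak_eq_weight [OF s] by (simp add: l_def m_def max_def)
    also have "\<dots> \<le> bohr_peak s * bohr_weight s k"
      using True m s that bohr_peak_ge_1 [OF s] by (intro mult_left_mono bohr_weight_mono) auto
    finally show ?thesis .
  next
    case False
    have "bohr_weight s k \<ge> 0" using s by (simp add: bohr_weight_def)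
    then show ?thesis using bohr_peak_ge_1 [OF s] mult_right_mono [of 1 "bohr_peak s" "bohr_weight s k"] False
      by (simp add: l_def max_def)
  qed
  have "(\<Sum>k=1..n. bohr_weight s k * x k) \<le> (\<Sum>k=1..n. l k * x k)"
    by (intro sum_mono mult_right_mono w_le x)
  also have "\<dots> \<le> (\<Sum>k=1..n. l k * y k)"
  proof (rule sum_antimono_weights_le [OF _ _ le])
    show "l (Suc n) \<le> l n" for n
      unfolding l_def by (rule bohr_weight_antimono) (use s m in \<open>auto simp: max_def\<close>)
    show "l n \<ge> 0" for n
      unfolding l_def bohr_weight_def using s by auto
  qed
  also have "\<dots> \<le> (\<Sum>k=1..n. bohr_peak s * bohr_weight s k * y k)"
    by (intro sum_mono mult_right_mono l_le y) auto
  finally show ?thesis by (simp add: sum_distrib_left mult_ac)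
qed

text \<open>The term of index 0 contributes \<open>a\<close>. The rest is bounded by Cauchy-Schwarz
  and the weighted Rogosinski inequality by \<open>(1 - a\<^sup>2) / a * bohr_lhs a s\<close>, which
  the equation for \<open>s\<close> makes equal to \<open>1 - a\<close>.\<close>

lemma bohr_sum_at_radius_le:
  fixes b :: "nat \<Rightarrow> complex"
  assumes a: "norm (b 0) = a" "0 < a" "a < 1" and s: "s \<ge> 1"
    and eq: "bohr_lhs a s = a / (1 + a)"
    and rog: "\<And>n. (\<Sum>k=1..n. (cmod (b k))\<^sup>2) \<le> (\<Sum>k=1..n. (1 - a\<^sup>2)\<^sup>2 * (a\<^sup>2) ^ (k - 1))"
  shows "(\<Sum>n\<le>N. real (n + 1) * norm (b n) * (a * s / (1 + s)) ^ n) \<le> 1"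
proof -
  text \<open>Cauchy--Schwarz is split so that it is an equality for the coefficients
    \<open>(1 - a\<^sup>2) * a ^ (n - 1)\<close> of the Moebius map.\<close>
  define \<rho> where "\<rho> = s / (s + 1)"
  have \<rho>: "\<rho> > 0" using s by (simp add: \<rho>_def)
  have x: "0 < a\<^sup>2 * \<rho>" "a\<^sup>2 * \<rho> < 1"
    using bohr_ratio_bounds [of a s] a s by (auto simp: \<rho>_def)
  define Q where "Q = (\<Sum>n=1..N. real (n + 1) * (a\<^sup>2 * \<rho>) ^ n)"
  define q where "q = 1 / (1 - a\<^sup>2 * \<rho>)\<^sup>2 - 1"
  have "Q \<ge> 0" unfolding Q_def using x by (intro sum_nonneg) auto
  \<comment> \<open>\<open>1 + Q\<close> is a partial sum of the derivative of the geometric series,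
    whose sum is \<open>1 + q\<close>.\<close>
  have "1 + Q = (\<Sum>n<Suc N. real (Suc n) * (a\<^sup>2 * \<rho>) ^ n)"
    unfolding Q_def lessThan_Suc_atMost atMost_atLeast0
    by (subst (2) sum.atLeast_Suc_atMost) auto
  also have "\<dots> \<le> 1 / (1 - a\<^sup>2 * \<rho>)\<^sup>2"
    using geometric_deriv_sums [of "a\<^sup>2 * \<rho>"] x
    by (intro sum_le_suminf [THEN order_trans]) (auto simp: sums_iff)
  finally have "Q \<le> q" by (simp add: q_def)
  define T where "T = (\<Sum>n=1..N. real (n + 1) * norm (b n) * (a * \<rho>) ^ n)"
  have "T\<^sup>2 = (\<Sum>n=1..N. (sqrt (bohr_weight s n) * norm (b n)) * sqrt (real (n + 1) * (a\<^sup>2 * \<rho>) ^ n))\<^sup>2"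
  proof -
    have "sqrt (bohr_weight s n) * norm (b n) * sqrt (real (n + 1) * (a\<^sup>2 * \<rho>) ^ n)
        = real (n + 1) * norm (b n) * (a * \<rho>) ^ n" for n
    proof -
      have "bohr_weight s n * (real (n + 1) * (a\<^sup>2 * \<rho>) ^ n) = (real (n + 1) * (a * \<rho>) ^ n)\<^sup>2"
        by (simp add: bohr_weight_def \<rho>_def [symmetric] power2_eq_square power_mult_distrib mult_ac)
      then have "sqrt (bohr_weight s n) * sqrt (real (n + 1) * (a\<^sup>2 * \<rho>) ^ n) = real (n + 1) * (a * \<rho>) ^ n"
        unfolding real_sqrt_mult [symmetric] using a \<rho> by simp
      then show ?thesis by (simp add: mult_ac)
    qed
    then show ?thesis unfolding T_def by (simp only:)
  qed
  also have "\<dots> \<le> (\<Sum>n=1..N. (sqrt (bohr_weight s n) * norm (b n))\<^sup>2)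
      * (\<Sum>n=1..N. (sqrt (real (n + 1) * (a\<^sup>2 * \<rho>) ^ n))\<^sup>2)"
    by (rule Cauchy_Schwarz_ineq_sum)
  also have "(\<Sum>n=1..N. (sqrt (real (n + 1) * (a\<^sup>2 * \<rho>) ^ n))\<^sup>2) = Q"
    unfolding Q_def using x by (intro sum.cong refl real_sqrt_pow2) auto
  also have "(\<Sum>n=1..N. (sqrt (bohr_weight s n) * norm (b n))\<^sup>2)
      = (\<Sum>n=1..N. bohr_weight s n * (norm (b n))\<^sup>2)"
    using s by (simp add: power_mult_distrib bohr_weight_def)
  also have "\<dots> * Q \<le> (bohr_peak s * (\<Sum>n=1..N. bohr_weight s n * ((1 - a\<^sup>2)\<^sup>2 * (a\<^sup>2) ^ (n - 1)))) * Q"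
    using \<open>Q \<ge> 0\<close> by (intro mult_right_mono sum_bohr_weight_le s rog) auto
  also have "(\<Sum>n=1..N. bohr_weight s n * ((1 - a\<^sup>2)\<^sup>2 * (a\<^sup>2) ^ (n - 1))) = ((1 - a\<^sup>2) / a)\<^sup>2 * Q"
    unfolding Q_def sum_distrib_left
  proof (intro sum.cong refl)
    fix n assume "n \<in> {1..N}"
    then obtain m where "n = Suc m" by (cases n) auto
    then show "bohr_weight s n * ((1 - a\<^sup>2)\<^sup>2 * (a\<^sup>2) ^ (n - 1))
        = ((1 - a\<^sup>2) / a)\<^sup>2 * (real (n + 1) * (a\<^sup>2 * \<rho>) ^ n)"
      using a by (simp add: bohr_weight_def \<rho>_def [symmetric] power_mult_distrib power_divide)
  qed
  \<comment> \<open>Both Cauchy-Schwarz factors are now multiples of the same \<open>Q\<close>, so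
    the bound is a perfect square.\<close>
  also have "bohr_peak s * (((1 - a\<^sup>2) / a)\<^sup>2 * Q) * Q = (sqrt (bohr_peak s) * ((1 - a\<^sup>2) / a) * Q)\<^sup>2"
    using bohr_peak_ge_1 [OF s] by (simp add: power_mult_distrib) (simp add: power2_eq_square)
  finally have "T \<le> sqrt (bohr_peak s) * ((1 - a\<^sup>2) / a) * Q"
    by (rule power2_le_imp_le)
       (use \<open>Q \<ge> 0\<close> a bohr_peak_ge_1 [OF s] in \<open>auto intro!: mult_nonneg_nonneg divide_nonneg_pos simp: power_le_one\<close>)
  also have "\<dots> \<le> sqrt (bohr_peak s) * ((1 - a\<^sup>2) / a) * q"
    using \<open>Q \<le> q\<close> a bohr_peak_ge_1 [OF s]
    by (intro mult_left_mono mult_nonneg_nonneg divide_nonneg_pos) (auto simp: power_le_one)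
  also have "\<dots> = (1 - a\<^sup>2) / a * bohr_lhs a s"
    by (simp add: bohr_lhs_def q_def \<rho>_def mult_ac)
  also have "\<dots> = 1 - a"
    unfolding eq using a by (simp add: divide_simps) (simp add: power2_eq_square algebra_simps)
  finally have "T \<le> 1 - a" .
  moreover have "(\<Sum>n\<le>N. real (n + 1) * norm (b n) * (a * s / (1 + s)) ^ n) = a + T"
    unfolding T_def \<rho>_def atMost_atLeast0
    by (subst sum.atLeast_Suc_atMost) (use a in \<open>auto simp: add.commute\<close>)
  ultimately show ?thesis by linarith
qed

text \<open>Smaller radii only decrease the terms, and nonnegative terms with partial sums at most 1
  yield both the summability and the bound.\<close>

lemma bohr_radius_id_deriv_ge:
  assumes a: "0 < a" "a < 1" and s: "s \<ge> 1" and eq: "bohr_lhs a s = a / (1 + a)"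
  shows "ereal (a * s / (1 + s)) \<le> bohr_radius_id_deriv a"
  unfolding bohr_radius_id_deriv_def
proof (intro Sup_upper imageI CollectI conjI allI impI ballI)
  show "0 \<le> a * s / (1 + s)" using a s by simp
next
  fix f :: "complex \<Rightarrow> complex" and c :: "nat \<Rightarrow> complex" and r :: real
  assume *: "f holomorphic_on ball 0 1 \<and>
      (\<forall>z\<in>ball 0 1. (\<lambda>n. c (Suc n) * z ^ Suc n) sums f z) \<and>
      norm (c 1) = a \<and> sup_norm_disc f \<le> 1"
    and r: "r \<in> {0..a * s / (1 + s)}"
  have f: "norm (f z) \<le> 1" if "norm z < 1" for z
  proof -
    have "ereal (norm (f z)) \<le> sup_norm_disc f"
      unfolding sup_norm_disc_def by (rule SUP_upper) (use that in simp)
    also have "\<dots> \<le> 1" using * by blast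
    finally show ?thesis by simp
  qed
  have rog: "(\<Sum>k=1..n. (cmod (c (Suc k)))\<^sup>2) \<le> (\<Sum>k=1..n. (1 - a\<^sup>2)\<^sup>2 * (a\<^sup>2) ^ (k - 1))" for n
    by (rule rogosinski_coeff_bound_zero [where f = f]) (use * f a in auto)
  define t where "t n = real (Suc n) * norm (c (Suc n)) * r ^ n" for n
  have t0: "t n \<ge> 0" for n using r by (simp add: t_def)
  have le: "(\<Sum>n<N. t n) \<le> 1" for N
  proof -
    have "(\<Sum>n<N. t n) \<le> (\<Sum>n\<le>N. t n)"
      using t0 by (intro sum_mono2) auto
    also have "\<dots> \<le> (\<Sum>n\<le>N. real (n + 1) * norm (c (Suc n)) * (a * s / (1 + s)) ^ n)"
      unfolding t_def using r by (intro sum_mono mult_mono power_mono) auto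
    also have "\<dots> \<le> 1"
      by (rule bohr_sum_at_radius_le [where b = "\<lambda>n. c (Suc n)"]) (use * a s eq rog in auto)
    finally show ?thesis .
  qed
  have "summable t"
    by (rule summableI_nonneg_bounded [OF t0 le])
  moreover have "suminf t \<le> 1"
    by (rule suminf_le_const [OF \<open>summable t\<close> le])
  ultimately show "summable (\<lambda>n. real (Suc n) * norm (c (Suc n)) * r ^ n)"
    and "(\<Sum>n. real (Suc n) * norm (c (Suc n)) * r ^ n) \<le> 1"
    unfolding t_def by simp_all
qed

section \<open>The upper bound from an explicit function\<close>

text \<open>For \<open>z * (a - z) / (1 - a * z)\<close> the sum has the closed form
  \<open>a + (1 - a\<^sup>2) / a * (1 / (1 - a * r)\<^sup>2 - 1)\<close>, which exceeds 1 for
  \<open>r\<close> between \<open>R0\<close> and \<open>1 / a\<close>.\<close>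

lemma bohr_radius_id_deriv_le:
  assumes a: "0 < a" "a < 1"
  shows "bohr_radius_id_deriv a \<le> ereal (1 / a * (1 - sqrt ((1 + a) / (1 + 2 * a))))"
proof -
  define R0 where "R0 = 1 / a * (1 - sqrt ((1 + a) / (1 + 2 * a)))"
  define f where "f z = z * ((of_real a - z) / (1 - of_real a * z))" for z :: complex
  \<comment> \<open>The first case covers both \<open>c 0 = 0\<close> and \<open>c 1 = a\<close>;
    the exponent \<open>n - 2\<close> occurs only for \<open>n \<ge> 2\<close>.\<close>
  define c :: "nat \<Rightarrow> complex" where
    "c = (\<lambda>n. if n \<le> 1 then of_real (a * real n) else - of_real ((1 - a\<^sup>2) * a ^ (n - 2)))"
  have hol: "f holomorphic_on ball 0 1" and f_le: "norm (f z) \<le> 1"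
    and sums: "(\<lambda>n. c (Suc n) * z ^ Suc n) sums f z" if "norm z < 1" for z
  proof -
    have nz: "1 - of_real a * z \<noteq> 0" if "norm z < 1" for z :: complex
      using norm_moebius_le_1(2) [of "of_real a" z] that a by simp
    show "f holomorphic_on ball 0 1"
      unfolding f_def by (intro holomorphic_intros) (use nz in auto)
    have "norm ((of_real a - z) / (1 - of_real a * z)) \<le> 1"
      using norm_moebius_le_1(1) [of "of_real a" z] that a
      by (simp add: norm_divide norm_minus_commute)
    then show "norm (f z) \<le> 1"
      unfolding f_def norm_mult using that by (intro mult_le_one) auto
    have "norm (of_real a * z) < 1"
      using mult_strict_mono [of a 1 "norm z" 1] a that by (simp add: norm_mult)
    then have "(\<lambda>n. - of_real (1 - a\<^sup>2) * z\<^sup>2 * (of_real a * z) ^ n)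
        sums (- of_real (1 - a\<^sup>2) * z\<^sup>2 * (1 / (1 - of_real a * z)))"
      by (intro sums_mult geometric_sums)
    also have "(\<lambda>n. - of_real (1 - a\<^sup>2) * z\<^sup>2 * (of_real a * z) ^ n) = (\<lambda>n. c (Suc (Suc n)) * z ^ Suc (Suc n))"
      by (simp add: c_def power_mult_distrib power2_eq_square algebra_simps fun_eq_iff)
    finally have "(\<lambda>n. c (Suc n) * z ^ Suc n)
        sums (- of_real (1 - a\<^sup>2) * z\<^sup>2 * (1 / (1 - of_real a * z)) + c (Suc 0) * z ^ Suc 0)"
      by (rule sums_Suc)
    also have "- of_real (1 - a\<^sup>2) * z\<^sup>2 * (1 / (1 - of_real a * z)) + c (Suc 0) * z ^ Suc 0 = f z"
      using nz [OF that] by (simp add: c_def f_def field_simps) (simp add: algebra_simps power2_eq_square)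
    finally show "(\<lambda>n. c (Suc n) * z ^ Suc n) sums f z" .
  qed
  \<comment> \<open>The condition \<open>r < 1 / a\<close> keeps the series convergent, so that
    \<open>suminf\<close> is its true sum.\<close>
  have big: "(\<Sum>n. real (Suc n) * norm (c (Suc n)) * r ^ n) > 1" if r: "R0 < r" "r < 1 / a" "r > 0" for r
  proof -
    define Q where "Q = (1 + a) / (1 + 2 * a)"
    have Q: "Q > 0" using a by (simp add: Q_def)
    have x: "0 < a * r" "a * r < 1" using r a by (auto simp: field_simps)
    have "(\<lambda>n. real (Suc n) * (a * r) ^ n) sums (1 / (1 - a * r)\<^sup>2)"
      using geometric_deriv_sums [of "a * r"] x by simp
    then have "(\<lambda>n. real (Suc (Suc n)) * (a * r) ^ Suc n) sums (1 / (1 - a * r)\<^sup>2 - 1)"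
      by (subst sums_Suc_iff) simp
    then have "(\<lambda>n. (1 - a\<^sup>2) / a * (real (Suc (Suc n)) * (a * r) ^ Suc n))
        sums ((1 - a\<^sup>2) / a * (1 / (1 - a * r)\<^sup>2 - 1))"
      by (rule sums_mult)
    also have "(\<lambda>n. (1 - a\<^sup>2) / a * (real (Suc (Suc n)) * (a * r) ^ Suc n))
        = (\<lambda>n. real (Suc (Suc n)) * norm (c (Suc (Suc n))) * r ^ Suc n)"
    proof
      fix n
      have "norm (c (Suc (Suc n))) = (1 - a\<^sup>2) * a ^ n"
        using a unfolding c_def norm_minus_cancel norm_of_real
        by (simp add: norm_mult norm_power abs_square_le_1 power_le_one del: of_real_mult of_real_diff)
      then show "(1 - a\<^sup>2) / a * (real (Suc (Suc n)) * (a * r) ^ Suc n)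
          = real (Suc (Suc n)) * norm (c (Suc (Suc n))) * r ^ Suc n"
        using a by (simp add: power_mult_distrib)
    qed
    finally have "(\<lambda>n. real (Suc n) * norm (c (Suc n)) * r ^ n)
        sums ((1 - a\<^sup>2) / a * (1 / (1 - a * r)\<^sup>2 - 1) + real (Suc 0) * norm (c (Suc 0)) * r ^ 0)"
      by (rule sums_Suc)
    then have "(\<Sum>n. real (Suc n) * norm (c (Suc n)) * r ^ n)
        = (1 - a\<^sup>2) / a * (1 / (1 - a * r)\<^sup>2 - 1) + a"
      using a by (simp add: sums_iff c_def)
    moreover have "(1 - a\<^sup>2) / a * (1 / (1 - a * r)\<^sup>2 - 1) > 1 - a"
    proof -
      have "1 - sqrt Q < a * r"
        using r(1) a by (simp add: R0_def Q_def field_simps)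
      then have "(1 - a * r)\<^sup>2 < (sqrt Q)\<^sup>2"
        using x by (intro power_strict_mono) auto
      then have "(1 - a * r)\<^sup>2 < Q" using Q by simp
      then have "1 / Q < 1 / (1 - a * r)\<^sup>2"
        using x Q by (intro divide_strict_left_mono) auto
      moreover have "1 / Q - 1 = a / (1 + a)"
        using a by (simp add: Q_def field_simps)
      ultimately have "a / (1 + a) < 1 / (1 - a * r)\<^sup>2 - 1" by linarith
      moreover have "(1 - a\<^sup>2) / a > 0" using a by (simp add: abs_square_less_1)
      ultimately have "(1 - a\<^sup>2) / a * (a / (1 + a)) < (1 - a\<^sup>2) / a * (1 / (1 - a * r)\<^sup>2 - 1)"
        by (rule mult_strict_left_mono)
      moreover have "(1 - a\<^sup>2) / a * (a / (1 + a)) = 1 - a"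
        using a by (simp add: divide_simps) (simp add: power2_eq_square algebra_simps)
      ultimately show ?thesis by simp
    qed
    ultimately show ?thesis by linarith
  qed
  have R0: "0 \<le> R0" "R0 < 1 / a"
    using a unfolding R0_def by (auto intro!: divide_nonneg_pos divide_strict_right_mono)
  have "sup_norm_disc f \<le> 1"
    unfolding sup_norm_disc_def by (rule SUP_least) (use f_le in auto)
  have "R \<le> R0" if R: "\<forall>f c. f holomorphic_on ball 0 1 \<and>
        (\<forall>z\<in>ball 0 1. (\<lambda>n. c (Suc n) * z ^ Suc n) sums f z) \<and>
        norm (c 1) = a \<and> sup_norm_disc f \<le> 1 \<longrightarrow>
        (\<forall>r\<in>{0..R}. summable (\<lambda>n. real (Suc n) * norm (c (Suc n)) * r ^ n) \<and>
                      (\<Sum>n. real (Suc n) * norm (c (Suc n)) * r ^ n) \<le> 1)" for R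
  proof (rule ccontr)
    assume "\<not> R \<le> R0"
    then obtain r where r: "R0 < r" "r < min R (1 / a)"
      using R0 dense [of R0 "min R (1 / a)"] by auto
    have "norm (c 1) = a" using a by (simp add: c_def)
    then have "(\<Sum>n. real (Suc n) * norm (c (Suc n)) * r ^ n) \<le> 1"
      using R [rule_format, of f c r] hol [of 0] sums \<open>sup_norm_disc f \<le> 1\<close> r R0 by simp
    with big [of r] r R0 show False by simp
  qed
  then show ?thesis
    unfolding bohr_radius_id_deriv_def R0_def [symmetric]
    by (intro Sup_least) (auto simp only: image_iff mem_Collect_eq ereal_less_eq Bex_def)
qed

section \<open>The threshold \<open>a0\<close> and the conclusion\<close>

text \<open>The difference of the two sides has the sign of a quartic \<open>q\<close> that
  decreases on the unit interval, so it changes sign once, from positive to negative.\<close>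

lemma bohr_threshold:
  "\<exists>a0::real. {x \<in> {0<..<1}. (1 - 2 / 3 * x\<^sup>2)\<^sup>2 = (1 + x) / (1 + 2 * x)} = {a0} \<and>
    0.429782 \<le> a0 \<and> a0 < 0.429783 \<and>
    (\<forall>a. 0 < a \<and> a \<le> a0 \<longrightarrow> (1 + a) / (1 + 2 * a) \<le> (1 - 2 / 3 * a\<^sup>2)\<^sup>2)"
proof -
  \<comment> \<open>Clearing the denominator \<open>1 + 2 * x\<close> leaves a quintic;
    \<open>q\<close> is what remains after its root at 0 is split off.\<close>
  define q where "q x = 1 - 4 / 3 * x - 8 / 3 * x\<^sup>2 + 4 / 9 * x ^ 3 + 8 / 9 * x ^ 4" for x :: real
  have q: "(1 - 2 / 3 * x\<^sup>2)\<^sup>2 - (1 + x) / (1 + 2 * x) = x * q x / (1 + 2 * x)" if "x > 0" for x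
    unfolding q_def using that
    by (simp add: divide_simps) (simp add: power2_eq_square power3_eq_cube power4_eq_xxxx algebra_simps)
  have mono: "q y < q x" if "0 \<le> x" "x < y" "y \<le> 1" for x y
  proof (rule DERIV_neg_imp_decreasing [OF that(2)])
    fix t assume t: "x \<le> t" "t \<le> y"
    then have t01: "0 \<le> t" "t \<le> 1" using that by auto
    have "(q has_real_derivative - 4 / 3 - 16 / 3 * t + 4 / 3 * t\<^sup>2 + 32 / 9 * t ^ 3) (at t)"
      unfolding q_def by (auto intro!: derivative_eq_intros)
    \<comment> \<open>The positive terms are then at most \<open>44 / 9 * t\<close>, which
      \<open>16 / 3 * t\<close> outweighs.\<close>
    moreover have "t\<^sup>2 \<le> t" "t ^ 3 \<le> t"
      using t01 power_decreasing [of 1 2 t] power_decreasing [of 1 3 t] by auto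
    then have "- 4 / 3 - 16 / 3 * t + 4 / 3 * t\<^sup>2 + 32 / 9 * t ^ 3 < 0"
      using t01 by linarith
    ultimately show "\<exists>d. (q has_real_derivative d) (at t) \<and> d < 0" by blast
  qed
  have "\<exists>x\<ge>0.429782. x \<le> 0.429783 \<and> q x = 0"
  proof (rule IVT2')
    show "q 0.429783 \<le> 0" "0 \<le> q 0.429782" by (simp_all add: q_def field_simps)
    show "continuous_on {0.429782..0.429783} q" unfolding q_def by (intro continuous_intros)
  qed simp
  then obtain a0 where a0: "0.429782 \<le> a0" "a0 \<le> 0.429783" "q a0 = 0" by blast
  have "q 0.429783 \<noteq> 0" by (simp add: q_def field_simps)
  then have lt: "a0 < 0.429783" using a0 by (cases "a0 = 0.429783") auto
  have uniq: "x = a0" if x: "x \<in> {0<..<1}" "(1 - 2 / 3 * x\<^sup>2)\<^sup>2 = (1 + x) / (1 + 2 * x)" for x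
  proof -
    have "q x = 0" using q [of x] x by auto
    then show ?thesis
      using mono [of x a0] mono [of a0 x] a0 x by (cases x a0 rule: linorder_cases) auto
  qed
  have a0': "(1 - 2 / 3 * a0\<^sup>2)\<^sup>2 = (1 + a0) / (1 + 2 * a0)" "a0 \<in> {0<..<1}"
    using q [of a0] a0 by auto
  have "{x \<in> {0<..<1}. (1 - 2 / 3 * x\<^sup>2)\<^sup>2 = (1 + x) / (1 + 2 * x)} = {a0}"
    using uniq a0' by blast
  moreover have "(1 + a) / (1 + 2 * a) \<le> (1 - 2 / 3 * a\<^sup>2)\<^sup>2" if a: "0 < a" "a \<le> a0" for a
  proof -
    have "q a \<ge> 0" using mono [of a a0] a a0 by (cases "a = a0") auto
    then have "a * q a / (1 + 2 * a) \<ge> 0" using a by simp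
    then show ?thesis using q [of a] a by linarith
  qed
  ultimately show ?thesis using a0(1) lt by (intro exI [of _ a0]) (intro conjI allI impI, auto)
qed

theorem theorem4:
  "\<exists>a0::real.
     {x \<in> {0<..<1}. (1 - 2 / 3 * x\<^sup>2)\<^sup>2 = (1 + x) / (1 + 2 * x)} = {a0} \<and>
     0.429782 \<le> a0 \<and> a0 < 0.429783 \<and>
     (\<forall>a. 0 < a \<and> a \<le> a0 \<longrightarrow>
        (\<exists>s::real.
           {t \<in> {1..}.
              sqrt ((of_int \<lfloor>t\<rfloor> + 1) / 2 * (t / (t + 1)) powi (\<lfloor>t\<rfloor> - 1)) *
                (1 / (1 - a\<^sup>2 * (t / (t + 1)))\<^sup>2 - 1) = a / (1 + a)} = {s} \<and>
           ereal (a * s / (1 + s)) \<le> bohr_radius_id_deriv a \<and>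
           bohr_radius_id_deriv a \<le> ereal (1 / a * (1 - sqrt ((1 + a) / (1 + 2 * a))))))"
proof -
  obtain a0 where a0: "{x \<in> {0<..<1}. (1 - 2 / 3 * x\<^sup>2)\<^sup>2 = (1 + x) / (1 + 2 * x)} = {a0::real}"
      "0.429782 \<le> a0" "a0 < 0.429783"
    and le: "\<And>a. 0 < a \<Longrightarrow> a \<le> a0 \<Longrightarrow> (1 + a) / (1 + 2 * a) \<le> (1 - 2 / 3 * a\<^sup>2)\<^sup>2"
    using bohr_threshold by blast
  have "\<exists>s. {t \<in> {1..}. bohr_lhs a t = a / (1 + a)} = {s} \<and>
      ereal (a * s / (1 + s)) \<le> bohr_radius_id_deriv a \<and>
      bohr_radius_id_deriv a \<le> ereal (1 / a * (1 - sqrt ((1 + a) / (1 + 2 * a))))"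
    if a: "0 < a" "a \<le> a0" for a
  proof -
    have a1: "a < 1" using a a0 by simp
    have a2: "a\<^sup>2 < 1" using a a1 by (simp add: abs_square_less_1)
    have "(1 + a) / (1 + 2 * a) \<le> (1 - 2 / 3 * a\<^sup>2)\<^sup>2" by (rule le [OF a])
    \<comment> \<open>The numbers \<open>2 / 3\<close> and \<open>1 / 2\<close> are
      \<open>t / (t + 1)\<close> at \<open>t = 2\<close> and \<open>t = 1\<close>;
      \<open>a\<^sup>2 < 1\<close> keeps the bases nonnegative.\<close>
    also have "\<dots> \<le> (1 - a\<^sup>2 * (1 / 2))\<^sup>2"
      using a2 by (intro power_mono) auto
    finally have "1 / (1 - a\<^sup>2 * (1 / 2))\<^sup>2 \<le> 1 / ((1 + a) / (1 + 2 * a))"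
      using a by (intro divide_left_mono mult_pos_pos zero_less_power) (use a2 in auto)
    also have "\<dots> = 1 + a / (1 + a)" using a by (simp add: field_simps)
    \<comment> \<open>Since \<open>bohr_peak 1 = 1\<close>, only the second factor remains at
      \<open>t = 1\<close>.\<close>
    finally have "bohr_lhs a 1 \<le> a / (1 + a)"
      by (simp add: bohr_lhs_def bohr_peak_def)
    then obtain s where s: "{t \<in> {1..}. bohr_lhs a t = a / (1 + a)} = {s}"
      using bohr_lhs_unique_solution a a1 by blast
    then have "s \<ge> 1" "bohr_lhs a s = a / (1 + a)" by auto
    then show ?thesis
      using s bohr_radius_id_deriv_ge bohr_radius_id_deriv_le a a1 by blast
  qed
  then show ?thesis
    unfolding bohr_lhs_def bohr_peak_def using a0 by blast
qed

end
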